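(* Let $1\leq p\leq q\leq\infty$. Then a bounded subset $A$ of a locally convex space $E$ is a $(p,q)$-$(V^\ast)$ set if and only if the adjoint operator $T_A^\ast:E'_\beta\to\ell_\infty(A)$ is $(q,p)$-convergent.
   Context: All locally convex spaces are Hausdorff, over $\mathbb{F}\in\{\mathbb{R},\mathbb{C}\}$. $E'_\beta$ is the dual $E'$ with the strong topology $\beta(E',E)$. For a non-empty bounded subset $A$ of $E$, $\ell_1^0(A)$ is the subspace of the Banach space $\ell_1(A)$ consisting of finitely supported vectors (so its Banach dual is $\ell_\infty(A)$), with canonical unit vectors $e_a$, $a\in A$; $T_A:\ell_1^0(A)\to E$ is the continuous linear map determined by $T_A(e_a)=a$ for $a\in A$, i.e. $T_A(\lambda_0e_{a_0}+\cdots+\lambda_ne_{a_n})=\lambda_0a_0+\cdots+\lambda_na_n$. A sequence $\{x_n\}_{n\in\omega}$ in a locally convex space $F$ is weakly $p$-summable if $(\langle\chi,x_n\rangle)_n\in\ell_p$ (or $\in c_0$ if $p=\infty$) for every $\chi\in F'$. A non-empty subset $A$ of $E$ is a $(p,q)$-$(V^\ast)$ set if $\big(\sup_{a\in A}|\langle\chi_n,a\rangle|\big)_n\in\ell_q$ (or $\in c_0$ if $q=\infty$) for every weakly $p$-summable sequence $\{\chi_n\}$ in $E'_\beta$. A linear map from a locally convex space $F$ to a Banach space $L$ is $(q,p)$-convergent if it sends weakly $p$-summable sequences $\{x_n\}$ in $F$ to sequences $\{y_n\}$ in $L$ with $(\|y_n\|)_n\in\ell_q$ (or $\in c_0$ if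 $q=\infty$). *)

theory Defs
  imports "HOL-Analysis.Analysis" "HOL-Library.Function_Algebras"
begin

text \<open>
  The scalar field is a type \<open>'k\<close> of sort \<open>{real_normed_field, banach}\<close>. The instances \<open>real\<close> and
  \<open>complex\<close> are, up to isometric isomorphism, the only ones (Gelfand-Mazur).

  A space is given by its scalar multiplication and its topology; its underlying set is the
  \<open>topspace\<close>, which may be a proper subspace of the type. This allows a space and its dual to be
  treated alike.
\<close>

section \<open>Locally convex spaces\<close>

locale locally_convex_space = vector_space sc
  for sc :: "'k::{real_normed_field, banach} \<Rightarrow> 'a::ab_group_add \<Rightarrow> 'a" +
  fixes T :: "'a topology"
  assumes subspace_topspace: "subspace (topspace T)"
    and Hausdorff: "Hausdorff_space T"
    and continuous_add: "continuous_map (prod_topology T T) T (\<lambda>(x, y). x + y)"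
    and continuous_scale: "continuous_map (prod_topology euclidean T) T (\<lambda>(c, x). sc c x)"
    and locally_convex: "\<And>U. openin T U \<Longrightarrow> 0 \<in> U \<Longrightarrow>
      \<exists>V. openin T V \<and> 0 \<in> V \<and> V \<subseteq> U \<and>
        (\<forall>x\<in>V. \<forall>y\<in>V. \<forall>t\<in>{0..1::real}. sc (of_real (1 - t)) x + sc (of_real t) y \<in> V)"

definition lcs_bounded ::
    "('k::{real_normed_field, banach} \<Rightarrow> 'a::ab_group_add \<Rightarrow> 'a) \<Rightarrow> 'a topology \<Rightarrow> 'a set \<Rightarrow> bool" where
  "lcs_bounded sc T B \<longleftrightarrow> B \<subseteq> topspace T \<and>
    (\<forall>U. openin T U \<and> 0 \<in> U \<longrightarrow> (\<exists>r>0::real. B \<subseteq> sc (of_real r) ` U))"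

definition linear_map_on ::
    "'a set \<Rightarrow> ('k::field \<Rightarrow> 'a::ab_group_add \<Rightarrow> 'a) \<Rightarrow> ('k \<Rightarrow> 'b::ab_group_add \<Rightarrow> 'b) \<Rightarrow> ('a \<Rightarrow> 'b) \<Rightarrow> bool" where
  "linear_map_on X s1 s2 f \<longleftrightarrow>
    (\<forall>x\<in>X. \<forall>y\<in>X. f (x + y) = f x + f y) \<and> (\<forall>c. \<forall>x\<in>X. f (s1 c x) = s2 c (f x))"

text \<open>Functionals are set to 0 off the space, so that each one is represented by a single function.\<close>

definition lcs_dual ::
    "('k::{real_normed_field, banach} \<Rightarrow> 'a::ab_group_add \<Rightarrow> 'a) \<Rightarrow> 'a topology \<Rightarrow> ('a \<Rightarrow> 'k) set" where
  "lcs_dual sc T = {\<phi>. linear_map_on (topspace T) sc (*) \<phi> \<and>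
    continuous_map T euclidean \<phi> \<and> (\<forall>x. x \<notin> topspace T \<longrightarrow> \<phi> x = 0)}"

definition fun_scale :: "'k::field \<Rightarrow> ('a \<Rightarrow> 'k) \<Rightarrow> 'a \<Rightarrow> 'k" where
  "fun_scale c f = (\<lambda>x. c * f x)"

text \<open>
  The strong topology is the topology on the dual generated by the seminorms
  \<open>\<phi> \<mapsto> sup {|\<phi> b| : b \<in> B}\<close> with \<open>B\<close> non-empty and bounded.
\<close>

definition strong_ball ::
    "('k::{real_normed_field, banach} \<Rightarrow> 'a::ab_group_add \<Rightarrow> 'a) \<Rightarrow> 'a topology \<Rightarrow>
      ('a \<Rightarrow> 'k) \<Rightarrow> 'a set \<Rightarrow> real \<Rightarrow> ('a \<Rightarrow> 'k) set" where
  "strong_ball sc T \<phi> B \<epsilon> = {\<psi> \<in> lcs_dual sc T. (SUP b\<in>B. norm (\<psi> b - \<phi> b)) < \<epsilon>}"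

definition strong_topology ::
    "('k::{real_normed_field, banach} \<Rightarrow> 'a::ab_group_add \<Rightarrow> 'a) \<Rightarrow> 'a topology \<Rightarrow> ('a \<Rightarrow> 'k) topology" where
  "strong_topology sc T = topology_generated_by
    {strong_ball sc T \<phi> B \<epsilon> | \<phi> B \<epsilon>. \<phi> \<in> lcs_dual sc T \<and> B \<noteq> {} \<and> lcs_bounded sc T B \<and> 0 < \<epsilon>}"


section \<open>Banach spaces\<close>

locale banach_space_on = vector_space sc
  for sc :: "'k::{real_normed_field, banach} \<Rightarrow> 'b::ab_group_add \<Rightarrow> 'b" +
  fixes L :: "'b set" and nrm :: "'b \<Rightarrow> real"
  assumes subspace_carrier: "subspace L"
    and nrm_nonneg: "x \<in> L \<Longrightarrow> 0 \<le> nrm x"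
    and nrm_eq_0: "x \<in> L \<Longrightarrow> nrm x = 0 \<longleftrightarrow> x = 0"
    and nrm_scale: "x \<in> L \<Longrightarrow> nrm (sc c x) = norm c * nrm x"
    and nrm_triangle: "x \<in> L \<Longrightarrow> y \<in> L \<Longrightarrow> nrm (x + y) \<le> nrm x + nrm y"
    and complete: "range X \<subseteq> L \<Longrightarrow> (\<And>\<epsilon>. 0 < \<epsilon> \<Longrightarrow> \<exists>N. \<forall>m\<ge>N. \<forall>n\<ge>N. nrm (X m - X n) < \<epsilon>) \<Longrightarrow>
      \<exists>l\<in>L. (\<lambda>n. nrm (X n - l)) \<longlonglongrightarrow> 0"

definition linf :: "'a set \<Rightarrow> ('a \<Rightarrow> 'k::real_normed_field) set" where
  "linf A = {f. (\<forall>a. a \<notin> A \<longrightarrow> f a = 0) \<and> bdd_above ((\<lambda>a. norm (f a)) ` A)}"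

definition linf_norm :: "'a set \<Rightarrow> ('a \<Rightarrow> 'k::real_normed_field) \<Rightarrow> real" where
  "linf_norm A f = (SUP a\<in>A. norm (f a))"


section \<open>Summability, convergent operators and \<open>V\<^sup>*\<close> sets\<close>

definition lp_or_c0 :: "ereal \<Rightarrow> (nat \<Rightarrow> 'k::real_normed_vector) \<Rightarrow> bool" where
  "lp_or_c0 p x \<longleftrightarrow>
    (if p = \<infinity> then x \<longlonglongrightarrow> 0 else summable (\<lambda>n. norm (x n) powr real_of_ereal p))"

definition weakly_summable ::
    "('k::{real_normed_field, banach} \<Rightarrow> 'a::ab_group_add \<Rightarrow> 'a) \<Rightarrow> 'a topology \<Rightarrow> ereal \<Rightarrow> (nat \<Rightarrow> 'a) \<Rightarrow> bool" where
  "weakly_summable sc T p x \<longleftrightarrow>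
    range x \<subseteq> topspace T \<and> (\<forall>\<phi>\<in>lcs_dual sc T. lp_or_c0 p (\<lambda>n. \<phi> (x n)))"

text \<open>\<open>bdd_above\<close> says that the suprema are finite; for real \<open>SUP\<close> this has to be required.\<close>

definition V_star_set ::
    "('k::{real_normed_field, banach} \<Rightarrow> 'a::ab_group_add \<Rightarrow> 'a) \<Rightarrow> 'a topology \<Rightarrow> ereal \<Rightarrow> ereal \<Rightarrow> 'a set \<Rightarrow> bool" where
  "V_star_set sc T p q A \<longleftrightarrow> A \<noteq> {} \<and> A \<subseteq> topspace T \<and>
    (\<forall>\<phi>. weakly_summable fun_scale (strong_topology sc T) p \<phi> \<longrightarrow>
      (\<forall>n. bdd_above ((\<lambda>a. norm (\<phi> n a)) ` A)) \<and> lp_or_c0 q (\<lambda>n. SUP a\<in>A. norm (\<phi> n a)))"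

definition qp_convergent ::
    "ereal \<Rightarrow> ereal \<Rightarrow> ('k::{real_normed_field, banach} \<Rightarrow> 'a::ab_group_add \<Rightarrow> 'a) \<Rightarrow> 'a topology \<Rightarrow>
      ('k \<Rightarrow> 'b::ab_group_add \<Rightarrow> 'b) \<Rightarrow> 'b set \<Rightarrow> ('b \<Rightarrow> real) \<Rightarrow> ('a \<Rightarrow> 'b) \<Rightarrow> bool" where
  "qp_convergent q p s T s' L nrm u \<longleftrightarrow>
    locally_convex_space s T \<and> banach_space_on s' L nrm \<and>
    linear_map_on (topspace T) s s' u \<and> u ` topspace T \<subseteq> L \<and>
    (\<forall>x. weakly_summable s T p x \<longrightarrow> lp_or_c0 q (\<lambda>n. nrm (u (x n))))"


section \<open>The operator \<open>T\<^sub>A\<close> and its adjoint\<close>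

definition l10 :: "'a set \<Rightarrow> ('a \<Rightarrow> 'k::real_normed_field) set" where
  "l10 A = {f. finite {a. f a \<noteq> 0} \<and> {a. f a \<noteq> 0} \<subseteq> A}"

definition l10_norm :: "('a \<Rightarrow> 'k::real_normed_field) \<Rightarrow> real" where
  "l10_norm f = (\<Sum>a | f a \<noteq> 0. norm (f a))"

definition unit_vec :: "'a \<Rightarrow> 'a \<Rightarrow> 'k::real_normed_field" where
  "unit_vec a = (\<lambda>x. if x = a then 1 else 0)"

definition T_op :: "('k::real_normed_field \<Rightarrow> 'a::ab_group_add \<Rightarrow> 'a) \<Rightarrow> ('a \<Rightarrow> 'k) \<Rightarrow> 'a" where
  "T_op sc f = (\<Sum>a | f a \<noteq> 0. sc (f a) a)"

definition adjoint_op :: "'b set \<Rightarrow> ('b \<Rightarrow> 'a) \<Rightarrow> ('a \<Rightarrow> 'k::zero) \<Rightarrow> 'b \<Rightarrow> 'k" where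
  "adjoint_op X u \<phi> = (\<lambda>x. if x \<in> X then \<phi> (u x) else 0)"

definition l10_dual :: "'a set \<Rightarrow> (('a \<Rightarrow> 'k::real_normed_field) \<Rightarrow> 'k) set" where
  "l10_dual A = {\<Phi>. linear_map_on (l10 A) fun_scale (*) \<Phi> \<and>
    (\<exists>C. \<forall>f\<in>l10 A. norm (\<Phi> f) \<le> C * l10_norm f) \<and> (\<forall>f. f \<notin> l10 A \<longrightarrow> \<Phi> f = 0)}"

text \<open>The canonical identification of the dual of \<open>\<ell>\<^sub>1\<^sup>0(A)\<close> with \<open>\<ell>\<^sub>\<infinity>(A)\<close>.\<close>

definition l10_dual_to_linf :: "'a set \<Rightarrow> (('a \<Rightarrow> 'k::real_normed_field) \<Rightarrow> 'k) \<Rightarrow> 'a \<Rightarrow> 'k" where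
  "l10_dual_to_linf A \<Phi> = (\<lambda>a. if a \<in> A then \<Phi> (unit_vec a) else 0)"

definition T_adjoint :: 
    "('k::real_normed_field \<Rightarrow> 'a::ab_group_add \<Rightarrow> 'a) \<Rightarrow> 'a set \<Rightarrow> ('a \<Rightarrow> 'k) \<Rightarrow> 'a \<Rightarrow> 'k" where
  "T_adjoint sc A \<phi> = l10_dual_to_linf A (adjoint_op (l10 A) (T_op sc) \<phi>)"

section \<open>The spaces above are of the required kind\<close>

text \<open>
  \<open>\<ell>\<^sub>\<infinity>(A)\<close> is a Banach space, the strong dual of a locally convex space is locally convex and
  Hausdorff, and \<open>l10_dual_to_linf\<close> is an isometric bijection.
\<close>

lemma vector_space_fun_scale: "vector_space (fun_scale :: 'k::field \<Rightarrow> ('a \<Rightarrow> 'k) \<Rightarrow> 'a \<Rightarrow> 'k)"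
  by unfold_locales (auto simp: fun_scale_def fun_eq_iff algebra_simps)

lemma subspace_fun_scale:
  "module.subspace fun_scale S \<longleftrightarrow>
    0 \<in> S \<and> (\<forall>f\<in>S. \<forall>g\<in>S. f + g \<in> S) \<and> (\<forall>c. \<forall>f\<in>S. fun_scale c f \<in> S)"
proof -
  interpret vector_space "fun_scale :: 'a \<Rightarrow> ('b \<Rightarrow> 'a) \<Rightarrow> 'b \<Rightarrow> 'a" by (rule vector_space_fun_scale)
  show ?thesis by (auto simp: subspace_def)
qed

lemma banach_space_linf:
  fixes A :: "'a set"
  assumes "A \<noteq> {}"
  shows "banach_space_on (fun_scale :: 'k \<Rightarrow> ('a \<Rightarrow> 'k::{real_normed_field, banach}) \<Rightarrow> _)
    (linf A) (linf_norm A)"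
proof -
  have sub: "module.subspace fun_scale (linf A :: ('a \<Rightarrow> 'k) set)"
    unfolding subspace_fun_scale
  proof (intro conjI ballI allI)
    show "0 \<in> (linf A :: ('a \<Rightarrow> 'k) set)" by (auto simp: linf_def)
  next
    fix f g :: "'a \<Rightarrow> 'k" assume fg: "f \<in> linf A" "g \<in> linf A"
    obtain M where "\<And>a. a \<in> A \<Longrightarrow> norm (f a) \<le> M"
      using fg(1) by (auto simp: linf_def bdd_above_def)
    moreover obtain N where "\<And>a. a \<in> A \<Longrightarrow> norm (g a) \<le> N"
      using fg(2) by (auto simp: linf_def bdd_above_def)
    ultimately have "\<And>a. a \<in> A \<Longrightarrow> norm (f a + g a) \<le> M + N"
      by (meson add_mono norm_triangle_le)
    then show "f + g \<in> linf A" using fg by (auto simp: linf_def bdd_above_def)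
  next
    fix c :: 'k and f :: "'a \<Rightarrow> 'k" assume f: "f \<in> linf A"
    then obtain M where "\<And>a. a \<in> A \<Longrightarrow> norm (f a) \<le> M" by (auto simp: linf_def bdd_above_def)
    then have "\<And>a. a \<in> A \<Longrightarrow> norm (c * f a) \<le> norm c * M" by (simp add: norm_mult mult_left_mono)
    then show "fun_scale c f \<in> linf A" using f by (auto simp: linf_def bdd_above_def fun_scale_def)
  qed
  have upper: "norm (f a) \<le> linf_norm A f" if "f \<in> linf A" for f :: "'a \<Rightarrow> 'k" and a
  proof (cases "a \<in> A")
    case True then show ?thesis using that by (auto simp: linf_def linf_norm_def intro: cSUP_upper)
  next
    case False
    obtain b where "b \<in> A" using assms by auto
    then have "norm (f b) \<le> linf_norm A f"
      using that by (auto simp: linf_def linf_norm_def intro: cSUP_upper)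
    then have "0 \<le> linf_norm A f" by (rule order_trans [OF norm_ge_zero])
    with False that show ?thesis by (simp add: linf_def)
  qed
  have least: "linf_norm A f \<le> M" if "\<And>a. a \<in> A \<Longrightarrow> norm (f a) \<le> M" for f :: "'a \<Rightarrow> 'k" and M
    unfolding linf_norm_def using that assms by (intro cSUP_least)
  have diff: "f - g \<in> linf A" if "f \<in> linf A" "g \<in> linf A" for f g :: "'a \<Rightarrow> 'k"
    using module.subspace_diff [OF _ sub that]
    by (simp add: module_iff_vector_space vector_space_fun_scale)
  have nonneg: "0 \<le> linf_norm A f" if "f \<in> linf A" for f :: "'a \<Rightarrow> 'k"
    using order_trans [OF norm_ge_zero upper [OF that]] .
  have scale_le: "linf_norm A (fun_scale c f) \<le> norm c * linf_norm A f" if "f \<in> linf A"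
    for c and f :: "'a \<Rightarrow> 'k"
    by (rule least) (simp add: fun_scale_def norm_mult mult_left_mono upper [OF that])
  show ?thesis
  proof (intro banach_space_on.intro banach_space_on_axioms.intro vector_space_fun_scale sub)
    fix f :: "'a \<Rightarrow> 'k" assume f: "f \<in> linf A"
    show "0 \<le> linf_norm A f" by (rule nonneg [OF f])
    show "linf_norm A f = 0 \<longleftrightarrow> f = 0"
    proof
      assume "linf_norm A f = 0"
      then have "norm (f a) \<le> 0" for a using upper [OF f, of a] by simp
      then show "f = 0" by (simp add: fun_eq_iff)
    next
      assume "f = 0" then show "linf_norm A f = 0" using assms by (simp add: linf_norm_def)
    qed
  next
    fix f :: "'a \<Rightarrow> 'k" and c :: 'k assume f: "f \<in> linf A"
    show "linf_norm A (fun_scale c f) = norm c * linf_norm A f"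
    proof (rule antisym [OF scale_le [OF f]], cases "c = 0")
      case True
      then show "norm c * linf_norm A f \<le> linf_norm A (fun_scale c f)"
        using nonneg sub f by (simp add: subspace_fun_scale)
    next
      case False
      then have "fun_scale (inverse c) (fun_scale c f) = f" by (simp add: fun_scale_def fun_eq_iff)
      moreover have "fun_scale c f \<in> linf A" using sub f by (simp add: subspace_fun_scale)
      ultimately have "linf_norm A f \<le> norm (inverse c) * linf_norm A (fun_scale c f)"
        using scale_le [of "fun_scale c f" "inverse c"] by (simp only:)
      then show "norm c * linf_norm A f \<le> linf_norm A (fun_scale c f)"
        using False by (simp add: norm_inverse norm_divide field_simps)
    qed
  next
    fix f g :: "'a \<Rightarrow> 'k" assume "f \<in> linf A" "g \<in> linf A"
    then show "linf_norm A (f + g) \<le> linf_norm A f + linf_norm A g"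
      by (intro least) (simp add: norm_triangle_le add_mono upper)
  next
    fix x :: "nat \<Rightarrow> 'a \<Rightarrow> 'k"
    assume x: "range x \<subseteq> linf A"
      and cau: "\<And>\<epsilon>. 0 < \<epsilon> \<Longrightarrow> \<exists>N. \<forall>m\<ge>N. \<forall>n\<ge>N. linf_norm A (x m - x n) < \<epsilon>"
    have xin: "x n \<in> linf A" for n using x by auto
    have le: "norm (x m a - x n a) \<le> linf_norm A (x m - x n)" for m n a
      using upper [OF diff [OF xin xin], where a=a] by simp
    have "Cauchy (\<lambda>n. x n a)" for a
    proof (unfold Cauchy_iff, intro allI impI)
      fix e :: real assume "0 < e"
      then obtain N where "\<forall>m\<ge>N. \<forall>n\<ge>N. linf_norm A (x m - x n) < e" using cau by blast
      then have "\<forall>m\<ge>N. \<forall>n\<ge>N. norm (x m a - x n a) < e" by (intro allI impI le_less_trans [OF le]) simp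
      then show "\<exists>M. \<forall>m\<ge>M. \<forall>n\<ge>M. norm (x m a - x n a) < e" by (rule exI)
    qed
    then have l: "(\<lambda>n. x n a) \<longlonglongrightarrow> lim (\<lambda>n. x n a)" for a
      by (simp add: Cauchy_convergent_iff convergent_LIMSEQ_iff)
    define l where "l a = lim (\<lambda>n. x n a)" for a
    note l = l [folded l_def]
    have tail: "\<exists>N. \<forall>m\<ge>N. \<forall>a. norm (x m a - l a) \<le> \<epsilon>" if "0 < \<epsilon>" for \<epsilon>
    proof -
      obtain N where N: "\<And>m n. m \<ge> N \<Longrightarrow> n \<ge> N \<Longrightarrow> linf_norm A (x m - x n) < \<epsilon>"
        using cau [OF \<open>0 < \<epsilon>\<close>] by blast
      have "norm (x m a - l a) \<le> \<epsilon>" if "m \<ge> N" for m a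
      proof (rule LIMSEQ_le_const2)
        show "(\<lambda>n. norm (x m a - x n a)) \<longlonglongrightarrow> norm (x m a - l a)"
          by (intro tendsto_intros l)
        show "\<exists>M. \<forall>n\<ge>M. norm (x m a - x n a) \<le> \<epsilon>"
          by (intro exI [of _ N] allI impI, rule order_trans [OF le less_imp_le [OF N [OF that]]])
      qed
      then show ?thesis by blast
    qed
    obtain N where N: "\<And>a. norm (x N a - l a) \<le> 1" using tail [of 1] by auto
    have lin: "l \<in> linf A"
    proof -
      have "l a = 0" if "a \<notin> A" for a
      proof -
        have "x n a = 0" for n using xin [of n] that by (simp add: linf_def)
        then show ?thesis using l [of a] by (simp add: LIMSEQ_const_iff)
      qed
      moreover have "norm (l a) \<le> linf_norm A (x N) + 1" for a
        using norm_triangle_sub [of "l a" "x N a"] N [of a] upper [OF xin, of N a]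
        by (simp add: norm_minus_commute)
      ultimately show ?thesis by (auto simp: linf_def bdd_above_def)
    qed
    have "(\<lambda>n. linf_norm A (x n - l)) \<longlonglongrightarrow> 0"
    proof (rule LIMSEQ_I)
      fix r :: real assume "0 < r"
      then obtain N where N: "\<And>m a. m \<ge> N \<Longrightarrow> norm (x m a - l a) \<le> r / 2"
        using tail [of "r/2"] by auto
      have "norm (linf_norm A (x n - l) - 0) < r" if "n \<ge> N" for n
        using least [of "x n - l" "r/2"] N [OF that] nonneg [OF diff [OF xin lin], of n] \<open>0 < r\<close> by simp
      then show "\<exists>no. \<forall>n\<ge>no. norm (linf_norm A (x n - l) - 0) < r" by blast
    qed
    with lin show "\<exists>l\<in>linf A. (\<lambda>n. linf_norm A (x n - l)) \<longlonglongrightarrow> 0" by blast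
  qed
qed

context locally_convex_space begin

lemma zero_in: "0 \<in> topspace T" using subspace_topspace by (rule subspace_0)

lemma lcs_bounded_Un:
  assumes "lcs_bounded sc T B" "lcs_bounded sc T C"
  shows "lcs_bounded sc T (B \<union> C)"
  unfolding lcs_bounded_def
proof (intro conjI allI impI)
  show "B \<union> C \<subseteq> topspace T" using assms by (auto simp: lcs_bounded_def)
  fix U assume "openin T U \<and> 0 \<in> U"
  then obtain V where V: "openin T V" "0 \<in> V" "V \<subseteq> U"
    and conv: "\<And>x y t. x \<in> V \<Longrightarrow> y \<in> V \<Longrightarrow> 0 \<le> t \<Longrightarrow> t \<le> (1::real)
       \<Longrightarrow> sc (of_real (1 - t)) x + sc (of_real t) y \<in> V"
    using locally_convex [of U] by (metis atLeastAtMost_iff)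
  obtain r s :: real where rs: "r > 0" "s > 0" "B \<subseteq> sc (of_real r) ` V" "C \<subseteq> sc (of_real s) ` V"
    using assms V by (meson lcs_bounded_def)
  have *: "sc (of_real u) ` V \<subseteq> sc (of_real (max r s)) ` U" if "0 < u" "u \<le> max r s" for u :: real
  proof
    fix x assume "x \<in> sc (of_real u) ` V"
    then obtain v where v: "v \<in> V" "x = sc (of_real u) v" by auto
    have "sc (of_real (u / max r s)) v \<in> V"
      using conv [OF V(2) v(1), of "u / max r s"] that by simp
    moreover have "x = sc (of_real (max r s)) (sc (of_real (u / max r s)) v)"
      using that v by (simp del: of_real_divide flip: of_real_mult)
    ultimately show "x \<in> sc (of_real (max r s)) ` U" using V by blast
  qed
  have "B \<union> C \<subseteq> sc (of_real (max r s)) ` U" using rs *[of r] *[of s] by auto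
  moreover have "max r s > 0" using rs by auto
  ultimately show "\<exists>r>0. B \<union> C \<subseteq> sc (of_real r) ` U" by blast
qed

lemma lcs_bounded_singleton:
  assumes x: "x \<in> topspace T" shows "lcs_bounded sc T {x}"
  unfolding lcs_bounded_def
proof (intro conjI allI impI)
  show "{x} \<subseteq> topspace T" using x by simp
  fix U assume U: "openin T U \<and> 0 \<in> U"
  let ?W = "{z \<in> topspace (prod_topology euclidean T). (case z of (c, x) \<Rightarrow> sc c x) \<in> U}"
  have "openin (prod_topology euclidean T) ?W"
    using openin_continuous_map_preimage [OF continuous_scale] U by blast
  moreover have "(0, x) \<in> ?W" using x U by simp
  ultimately have "\<exists>P Q. openin euclidean P \<and> openin T Q \<and> 0 \<in> P \<and> x \<in> Q \<and> P \<times> Q \<subseteq> ?W"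
    by (rule openin_prod_topology_alt [THEN iffD1, rule_format])
  then obtain P Q where PQ: "open P" "0 \<in> P" "x \<in> Q" and sub: "P \<times> Q \<subseteq> ?W"
    by (elim exE conjE) (rule that, simp_all only: open_openin)
  then obtain e where e: "e > 0" "ball 0 e \<subseteq> P" by (meson open_contains_ball)
  have "of_real (e/2) \<in> ball (0::'k) e" using e by simp
  then have "(of_real (e/2), x) \<in> P \<times> Q" using e PQ by blast
  then have "(of_real (e/2), x) \<in> ?W" by (rule subsetD [OF sub])
  then have "sc (of_real (e/2)) x \<in> U" by simp
  moreover have "x = sc (of_real (2/e)) (sc (of_real (e/2)) x)"
    using e by (simp flip: of_real_mult del: of_real_divide)
  moreover have "2/e > 0" using e by simp
  ultimately show "\<exists>r>0. {x} \<subseteq> sc (of_real r) ` U" by blast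
qed

lemma lcs_dual_bdd_above:
  assumes "f \<in> lcs_dual sc T" "lcs_bounded sc T B"
  shows "bdd_above ((\<lambda>b. norm (f b)) ` B)"
proof -
  have cont: "continuous_map T euclidean f" and lin: "linear_map_on (topspace T) sc (*) f"
    using assms by (auto simp: lcs_dual_def)
  let ?U = "{x \<in> topspace T. f x \<in> ball 0 1}"
  have "openin T ?U" using openin_continuous_map_preimage [OF cont] by (metis open_ball open_openin)
  moreover have "f 0 = 0"
  proof -
    have "f (sc 0 0) = 0 * f 0" using lin zero_in unfolding linear_map_on_def by blast
    then show ?thesis by simp
  qed
  ultimately obtain r :: real where r: "r > 0" "B \<subseteq> sc (of_real r) ` ?U"
    using assms(2) zero_in unfolding lcs_bounded_def by force
  have "norm (f b) \<le> r" if "b \<in> B" for b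
  proof -
    obtain u where u: "u \<in> topspace T" "norm (f u) < 1" "b = sc (of_real r) u"
      using subsetD [OF r(2) \<open>b \<in> B\<close>] by auto
    have "f b = of_real r * f u" using lin u unfolding linear_map_on_def by blast
    then show ?thesis using u r by (simp add: norm_mult)
  qed
  then show ?thesis by (auto simp: bdd_above_def)
qed

lemma subspace_lcs_dual: "module.subspace fun_scale (lcs_dual sc T)"
  unfolding subspace_fun_scale
proof (intro conjI ballI allI)
  show "0 \<in> lcs_dual sc T"
    by (auto simp: lcs_dual_def linear_map_on_def zero_fun_def)
next
  fix f g assume "f \<in> lcs_dual sc T" "g \<in> lcs_dual sc T"
  then show "f + g \<in> lcs_dual sc T"
    by (auto simp: lcs_dual_def linear_map_on_def plus_fun_def algebra_simps intro: continuous_map_add)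
next
  fix c :: 'k and f assume "f \<in> lcs_dual sc T"
  then show "fun_scale c f \<in> lcs_dual sc T"
    by (auto simp: lcs_dual_def linear_map_on_def fun_scale_def algebra_simps
        continuous_map_atin intro: tendsto_mult)
qed

lemma topspace_strong_topology: "topspace (strong_topology sc T) = lcs_dual sc T"
proof
  show "topspace (strong_topology sc T) \<subseteq> lcs_dual sc T"
    by (auto simp: strong_topology_def strong_ball_def)
  show "lcs_dual sc T \<subseteq> topspace (strong_topology sc T)"
  proof
    fix f assume f: "f \<in> lcs_dual sc T"
    then have "f \<in> strong_ball sc T f {0} 1" by (simp add: strong_ball_def)
    moreover have "strong_ball sc T f {0} 1 \<in>
      {strong_ball sc T \<phi> B \<epsilon> | \<phi> B \<epsilon>. \<phi> \<in> lcs_dual sc T \<and> B \<noteq> {} \<and> lcs_bounded sc T B \<and> 0 < \<epsilon>}"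
      using f lcs_bounded_singleton [OF zero_in] by (intro CollectI exI conjI) (rule refl, simp_all)
    ultimately show "f \<in> topspace (strong_topology sc T)"
      unfolding strong_topology_def topology_generated_by_topspace by (rule UnionI [rotated])
  qed
qed

lemma lcs_strong_dual: "locally_convex_space fun_scale (strong_topology sc T)"
proof -
  let ?D = "lcs_dual sc T"
  let ?bd = "\<lambda>B. B \<noteq> {} \<and> lcs_bounded sc T B"
  define p where "p B f = (SUP b\<in>B. norm (f b))" for B :: "'a set" and f :: "'a \<Rightarrow> 'k"
  interpret D: vector_space "fun_scale :: 'k \<Rightarrow> ('a \<Rightarrow> 'k) \<Rightarrow> 'a \<Rightarrow> 'k" by (rule vector_space_fun_scale)
  note subD = subspace_lcs_dual
  have ball: "strong_ball sc T f B e = {g \<in> ?D. p B (g - f) < e}" for f B e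
    by (simp add: strong_ball_def p_def)
  have up: "norm (f b) \<le> p B f" if "f \<in> ?D" "?bd B" "b \<in> B" for f B b
    unfolding p_def using lcs_dual_bdd_above [OF that(1)] that by (intro cSUP_upper) auto
  have least: "p B f \<le> M" if "?bd B" "\<And>b. b \<in> B \<Longrightarrow> norm (f b) \<le> M" for f B M
    unfolding p_def using that by (intro cSUP_least) auto
  have nonneg: "0 \<le> p B f" if "f \<in> ?D" "?bd B" for f B
    using up [OF that] that by (metis all_not_in_conv norm_ge_zero order_trans)
  have tri: "p B (f + g) \<le> p B f + p B g" if "f \<in> ?D" "g \<in> ?D" "?bd B" for f g B
    using that up by (intro least) (auto intro!: norm_triangle_le add_mono)
  have psc: "p B (fun_scale c f) \<le> norm c * p B f" if "f \<in> ?D" "?bd B" for c f B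
    using that up by (intro least) (auto simp: fun_scale_def norm_mult intro!: mult_left_mono)
  have mono: "p B f \<le> p (B \<union> C) f" "p C f \<le> p (B \<union> C) f" if "f \<in> ?D" "?bd B" "?bd C" for f B C
    using that up [OF that(1), of "B \<union> C"] lcs_bounded_Un [of B C] by (auto intro!: least)
  have p0: "p B 0 = 0" if "?bd B" for B
    using that by (simp add: p_def)
  have bdU: "?bd (B \<union> C)" if "?bd B" "?bd C" for B C using that lcs_bounded_Un by auto
  have D0: "0 \<in> ?D" by (rule D.subspace_0 [OF subD])
  have Dadd: "f + g \<in> ?D" if "f \<in> ?D" "g \<in> ?D" for f g by (rule D.subspace_add [OF subD that])
  have Ddiff: "f - g \<in> ?D" if "f \<in> ?D" "g \<in> ?D" for f g by (rule D.subspace_diff [OF subD that])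
  have Dsc: "fun_scale c f \<in> ?D" if "f \<in> ?D" for c f by (rule D.subspace_scale [OF subD that])
  have bd0: "?bd {0}" using lcs_bounded_singleton zero_in by auto
  have tri3: "p B (f - h) \<le> p B (f - g) + p B (g - h)" if "f \<in> ?D" "g \<in> ?D" "h \<in> ?D" "?bd B" for f g h B
    using tri [of "f - g" "g - h" B] that Ddiff by simp
  define opn where "opn W \<longleftrightarrow> W \<subseteq> ?D \<and> (\<forall>f\<in>W. \<exists>B e. ?bd B \<and> 0 < e \<and> strong_ball sc T f B e \<subseteq> W)" for W
  have OI: "opn W" if "W \<subseteq> ?D" "\<And>f. f \<in> W \<Longrightarrow> \<exists>B e. ?bd B \<and> 0 < e \<and> strong_ball sc T f B e \<subseteq> W" for W
    unfolding opn_def by (intro conjI ballI that)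
  have OD: "W \<subseteq> ?D" if "opn W" for W using that by (simp add: opn_def)
  have OE: thesis if "opn W" "f \<in> W" "\<And>B e. ?bd B \<Longrightarrow> 0 < e \<Longrightarrow> strong_ball sc T f B e \<subseteq> W \<Longrightarrow> thesis" for W f thesis
  proof -
    have "\<exists>B e. ?bd B \<and> 0 < e \<and> strong_ball sc T f B e \<subseteq> W" using that(1,2) by (simp add: opn_def)
    then show ?thesis using that(3) by (elim exE conjE) simp
  qed
  have self: "f \<in> strong_ball sc T f B e" if "f \<in> ?D" "?bd B" "0 < e" for f B e
    using that p0 by (simp add: ball)
  have ballO: "opn (strong_ball sc T f B e)" if "f \<in> ?D" "?bd B" for f B e
  proof (rule OI)
    show "strong_ball sc T f B e \<subseteq> ?D" by (auto simp: ball)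
    fix g assume "g \<in> strong_ball sc T f B e"
    then have g: "g \<in> ?D" "p B (g - f) < e" by (auto simp: ball)
    have "strong_ball sc T g B (e - p B (g - f)) \<subseteq> strong_ball sc T f B e"
      using tri3 [of _ g f B] that g by (force simp: ball)
    then show "\<exists>B' e'. ?bd B' \<and> 0 < e' \<and> strong_ball sc T g B' e' \<subseteq> strong_ball sc T f B e"
      using that g by (intro exI [of _ B] exI [of _ "e - p B (g - f)"]) auto
  qed
  have op: "openin (strong_topology sc T) W \<longleftrightarrow> opn W" for W
  proof
    assume "openin (strong_topology sc T) W"
    then have "generate_topology_on {strong_ball sc T f B e | f B e. f \<in> ?D \<and> B \<noteq> {} \<and>
        lcs_bounded sc T B \<and> 0 < e} W"
      by (simp add: strong_topology_def openin_topology_generated_by_iff)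
    then show "opn W"
    proof induction
      case Empty then show ?case by (simp add: opn_def)
    next
      case (Int a b)
      show ?case
      proof (rule OI)
        show "a \<inter> b \<subseteq> ?D" using OD [OF Int.IH(1)] by auto
        fix f assume f: "f \<in> a \<inter> b"
        obtain B e where B: "?bd B" "0 < e" "strong_ball sc T f B e \<subseteq> a" using OE [OF Int.IH(1)] f by blast
        obtain C d where C: "?bd C" "0 < d" "strong_ball sc T f C d \<subseteq> b" using OE [OF Int.IH(2)] f by blast
        have fD: "f \<in> ?D" using f OD [OF Int.IH(1)] by auto
        have "strong_ball sc T f (B \<union> C) (min e d) \<subseteq> strong_ball sc T f B e \<inter> strong_ball sc T f C d"
        proof
          fix g assume "g \<in> strong_ball sc T f (B \<union> C) (min e d)"
          then have "g \<in> ?D" "p (B \<union> C) (g - f) < min e d" by (auto simp: ball)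
          with mono [OF Ddiff [OF _ fD], of g B C] B C
          show "g \<in> strong_ball sc T f B e \<inter> strong_ball sc T f C d" by (auto simp: ball)
        qed
        then have "strong_ball sc T f (B \<union> C) (min e d) \<subseteq> a \<inter> b" using B(3) C(3) by blast
        then show "\<exists>B e. ?bd B \<and> 0 < e \<and> strong_ball sc T f B e \<subseteq> a \<inter> b"
          using B(2) C(2) bdU [OF B(1) C(1)] by (intro exI [of _ "B \<union> C"] exI [of _ "min e d"]) simp
      qed
    next
      case (UN K)
      show ?case
      proof (rule OI)
        show "\<Union>K \<subseteq> ?D" using UN OD by (intro Sup_least) simp
        fix f assume "f \<in> \<Union>K"
        then obtain k where k: "k \<in> K" "f \<in> k" by blast
        obtain B e where "?bd B" "0 < e" "strong_ball sc T f B e \<subseteq> k" by (rule OE [OF UN.IH [OF k(1)] k(2)])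
        moreover have "k \<subseteq> \<Union>K" using k by blast
        ultimately show "\<exists>B e. ?bd B \<and> 0 < e \<and> strong_ball sc T f B e \<subseteq> \<Union>K"
          by (intro exI [of _ B] exI [of _ e]) (simp add: subset_trans)
      qed
    next
      case (Basis s)
      then obtain f B e where "s = strong_ball sc T f B e" "f \<in> ?D" "?bd B" by auto
      then show ?case using ballO [of f B e] by simp
    qed
  next
    assume W: "opn W"
    have "\<exists>S. openin (strong_topology sc T) S \<and> f \<in> S \<and> S \<subseteq> W" if f: "f \<in> W" for f
    proof -
      obtain B e where B: "?bd B" "0 < e" "strong_ball sc T f B e \<subseteq> W" by (rule OE [OF W f])
      have fD: "f \<in> ?D" using OD [OF W] f by auto
      have "strong_ball sc T f B e \<in> {strong_ball sc T f B e | f B e. f \<in> ?D \<and> B \<noteq> {} \<and>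
        lcs_bounded sc T B \<and> 0 < e}" using B fD by blast
      then have "openin (strong_topology sc T) (strong_ball sc T f B e)"
        unfolding strong_topology_def by (rule topology_generated_by_Basis)
      then show ?thesis using B(3) self [OF fD B(1,2)] by (intro exI [of _ "strong_ball sc T f B e"]) simp
    qed
    then show "openin (strong_topology sc T) W" by (subst openin_subopen) (intro ballI, simp)
  qed
  have opball: "openin (strong_topology sc T) (strong_ball sc T f B e)" if "f \<in> ?D" "?bd B" for f B e
    using ballO [OF that] by (simp add: op)
  note top = topspace_strong_topology
  show ?thesis
  proof (intro locally_convex_space.intro locally_convex_space_axioms.intro vector_space_fun_scale)
    show "D.subspace (topspace (strong_topology sc T))" using top subD by simp
    show "Hausdorff_space (strong_topology sc T)"
      unfolding Hausdorff_space_def top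
    proof (intro allI impI)
      fix f g assume fg: "f \<in> ?D \<and> g \<in> ?D \<and> f \<noteq> g"
      then obtain x where x: "f x \<noteq> g x" by auto
      then have xT: "x \<in> topspace T" using fg by (auto simp: lcs_dual_def)
      then have bd: "?bd {x}" using lcs_bounded_singleton by auto
      have "disjnt (strong_ball sc T f {x} (norm (f x - g x) / 2)) (strong_ball sc T g {x} (norm (f x - g x) / 2))"
      proof -
        have False if "norm (h x - f x) < norm (f x - g x) / 2" "norm (h x - g x) < norm (f x - g x) / 2" for h
          using that norm_triangle_ineq4 [of "h x - g x" "h x - f x"] by simp
        then show ?thesis by (auto simp: disjnt_iff ball p_def)
      qed
      moreover have "0 < norm (f x - g x) / 2" using x by simp
      ultimately show "\<exists>U V. openin (strong_topology sc T) U \<and> openin (strong_topology sc T) V \<and> f \<in> U \<and> g \<in> V \<and> disjnt U V"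
        using fg opball [OF _ bd] self [OF _ bd]
        by (intro exI [of _ "strong_ball sc T f {x} (norm (f x - g x) / 2)"]
            exI [of _ "strong_ball sc T g {x} (norm (f x - g x) / 2)"] conjI) simp_all
    qed
    show "continuous_map (prod_topology (strong_topology sc T) (strong_topology sc T)) (strong_topology sc T) (\<lambda>(f, g). f + g)"
      unfolding continuous_map
    proof (intro conjI allI impI)
      show "(\<lambda>(f, g). f + g) ` topspace (prod_topology (strong_topology sc T) (strong_topology sc T)) \<subseteq> topspace (strong_topology sc T)"
        using top Dadd by auto
      fix W assume "openin (strong_topology sc T) W"
      then have W: "opn W" using op by simp
      show "openin (prod_topology (strong_topology sc T) (strong_topology sc T))
        {z \<in> topspace (prod_topology (strong_topology sc T) (strong_topology sc T)). (case z of (f, g) \<Rightarrow> f + g) \<in> W}"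
        unfolding openin_prod_topology_alt
      proof (intro allI impI)
        fix f g assume "(f, g) \<in> {z \<in> topspace (prod_topology (strong_topology sc T) (strong_topology sc T)). (case z of (f, g) \<Rightarrow> f + g) \<in> W}"
        then have fg: "f \<in> ?D" "g \<in> ?D" "f + g \<in> W" using top by auto
        obtain B e where B: "?bd B" "0 < e" "strong_ball sc T (f + g) B e \<subseteq> W" by (rule OE [OF W fg(3)])
        have step: "f' + g' \<in> W" if "f' \<in> strong_ball sc T f B (e/2)" "g' \<in> strong_ball sc T g B (e/2)" for f' g'
        proof -
          have *: "f' \<in> ?D" "g' \<in> ?D" "p B (f' - f) < e/2" "p B (g' - g) < e/2" using that by (auto simp: ball)
          have eq: "(f' + g') - (f + g) = (f' - f) + (g' - g)" by simp
          have "p B ((f' + g') - (f + g)) \<le> p B (f' - f) + p B (g' - g)"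
            unfolding eq by (rule tri [OF Ddiff [OF *(1) fg(1)] Ddiff [OF *(2) fg(2)] B(1)])
          then have "p B ((f' + g') - (f + g)) < e" using *(3,4) by linarith
          then have "f' + g' \<in> strong_ball sc T (f + g) B e" using Dadd [OF *(1,2)] by (simp only: ball mem_Collect_eq)
          then show ?thesis by (rule subsetD [OF B(3)])
        qed
        show "\<exists>U V. openin (strong_topology sc T) U \<and> openin (strong_topology sc T) V \<and> f \<in> U \<and> g \<in> V \<and>
          U \<times> V \<subseteq> {z \<in> topspace (prod_topology (strong_topology sc T) (strong_topology sc T)). (case z of (f, g) \<Rightarrow> f + g) \<in> W}"
        proof (intro exI conjI)
          show "openin (strong_topology sc T) (strong_ball sc T f B (e/2))"
            "openin (strong_topology sc T) (strong_ball sc T g B (e/2))"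
            by (rule opball [OF fg(1) B(1)], rule opball [OF fg(2) B(1)])
          have "0 < e/2" using B(2) by simp
          then show "f \<in> strong_ball sc T f B (e/2)" "g \<in> strong_ball sc T g B (e/2)"
            by (rule self [OF fg(1) B(1)], rule self [OF fg(2) B(1)])
          have "strong_ball sc T f B (e/2) \<subseteq> ?D" "strong_ball sc T g B (e/2) \<subseteq> ?D" by (auto simp: ball)
          then show "strong_ball sc T f B (e/2) \<times> strong_ball sc T g B (e/2) \<subseteq>
            {z \<in> topspace (prod_topology (strong_topology sc T) (strong_topology sc T)). (case z of (f, g) \<Rightarrow> f + g) \<in> W}"
            unfolding topspace_prod_topology top using step by (auto simp: subset_iff)
        qed
      qed
    qed
    show "continuous_map (prod_topology euclidean (strong_topology sc T)) (strong_topology sc T) (\<lambda>(c, f). fun_scale c f)"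
      unfolding continuous_map
    proof (intro conjI allI impI)
      show "(\<lambda>(c, f). fun_scale c f) ` topspace (prod_topology euclidean (strong_topology sc T)) \<subseteq> topspace (strong_topology sc T)"
        using top Dsc by auto
      fix W assume "openin (strong_topology sc T) W"
      then have W: "opn W" using op by simp
      show "openin (prod_topology euclidean (strong_topology sc T))
        {z \<in> topspace (prod_topology euclidean (strong_topology sc T)). (case z of (c, f) \<Rightarrow> fun_scale c f) \<in> W}"
        unfolding openin_prod_topology_alt
      proof (intro allI impI)
        fix c f assume "(c, f) \<in> {z \<in> topspace (prod_topology euclidean (strong_topology sc T)). (case z of (c, f) \<Rightarrow> fun_scale c f) \<in> W}"
        then have f: "f \<in> ?D" "fun_scale c f \<in> W" using top by auto
        obtain B e where B: "?bd B" "0 < e" "strong_ball sc T (fun_scale c f) B e \<subseteq> W" by (rule OE [OF W f(2)])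
        have pf: "0 \<le> p B f" by (rule nonneg [OF f(1) B(1)])
        define d where "d = min 1 (e / 2 / (p B f + 1))"
        define h where "h = e / 2 / (norm c + 1)"
        have d: "0 < d" "d \<le> 1" using pf B(2) by (simp_all add: d_def)
        have "d * (p B f + 1) \<le> e / 2 / (p B f + 1) * (p B f + 1)"
          using pf by (intro mult_right_mono) (simp_all add: d_def)
        also have "\<dots> = e / 2" proof -
          have "p B f + 1 \<noteq> 0" using pf by linarith
          then show ?thesis by (rule nonzero_eq_divide_eq [THEN iffD1, OF _ refl])
        qed
        finally have d3: "d * (p B f + 1) \<le> e / 2" .
        have nc: "0 < norm c + 1" using norm_ge_zero [of c] by linarith
        have "norm c + 1 \<noteq> 0" using nc by linarith
        then have "h * (norm c + 1) = e / 2"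
          unfolding h_def by (rule nonzero_eq_divide_eq [THEN iffD1, OF _ refl])
        then have h2: "(norm c + 1) * h = e / 2" by (simp only: mult.commute)
        have h: "0 < h" unfolding h_def using B(2) nc by (intro divide_pos_pos) simp_all
        have step: "fun_scale c' f' \<in> W" if "c' \<in> Elementary_Metric_Spaces.ball c d" "f' \<in> strong_ball sc T f B h" for c' f'
        proof -
          have *: "f' \<in> ?D" "p B (f' - f) < h" "norm (c' - c) < d"
            using that by (auto simp: ball dist_norm norm_minus_commute)
          have eq: "fun_scale c' f' - fun_scale c f = fun_scale c' (f' - f) + fun_scale (c' - c) f"
            by (simp add: fun_scale_def fun_eq_iff algebra_simps)
          have "norm c' \<le> norm c + 1"
            using *(3) d norm_triangle_sub [of c' c] by linarith
          then have "norm c' * p B (f' - f) \<le> (norm c + 1) * p B (f' - f)"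
            using nonneg [OF Ddiff [OF *(1) f(1)] B(1)] by (intro mult_right_mono)
          also have "\<dots> < e / 2" unfolding h2 [symmetric] using *(2) nc by (rule mult_strict_left_mono)
          finally have 1: "norm c' * p B (f' - f) < e / 2" .
          have "norm (c' - c) * p B f \<le> d * (p B f + 1)"
            using *(3) pf d by (intro mult_mono) linarith+
          then have 2: "norm (c' - c) * p B f \<le> e / 2" using d3 by linarith
          have "p B (fun_scale c' f' - fun_scale c f) < e"
            unfolding eq
            using tri [OF Dsc Dsc B(1), OF Ddiff [OF *(1) f(1)] f(1), of c' "c' - c"]
              psc [OF Ddiff [OF *(1) f(1)] B(1), of c'] psc [OF f(1) B(1), of "c' - c"]
              1 2 by linarith
          then have "fun_scale c' f' \<in> strong_ball sc T (fun_scale c f) B e"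
            using Dsc [OF *(1)] by (simp only: ball mem_Collect_eq)
          then show ?thesis by (rule subsetD [OF B(3)])
        qed
        show "\<exists>U V. openin euclidean U \<and> openin (strong_topology sc T) V \<and> c \<in> U \<and> f \<in> V \<and>
          U \<times> V \<subseteq> {z \<in> topspace (prod_topology euclidean (strong_topology sc T)). (case z of (c, f) \<Rightarrow> fun_scale c f) \<in> W}"
        proof (intro exI conjI)
          show "openin euclidean (Elementary_Metric_Spaces.ball c d)" "c \<in> Elementary_Metric_Spaces.ball c d"
            using d by simp_all
          show "openin (strong_topology sc T) (strong_ball sc T f B h)" "f \<in> strong_ball sc T f B h"
            by (rule opball [OF f(1) B(1)], rule self [OF f(1) B(1) h])
          have "strong_ball sc T f B h \<subseteq> ?D" by (auto simp: ball)
          then show "Elementary_Metric_Spaces.ball c d \<times> strong_ball sc T f B h \<subseteq>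
            {z \<in> topspace (prod_topology euclidean (strong_topology sc T)). (case z of (c, f) \<Rightarrow> fun_scale c f) \<in> W}"
            unfolding topspace_prod_topology top topspace_euclidean using step by (auto simp: subset_iff simp del: mem_ball)
        qed
      qed
    qed
    fix U assume "openin (strong_topology sc T) U" "0 \<in> U"
    then have "opn U" "0 \<in> U" by (simp_all add: op)
    then obtain B e where B: "?bd B" "0 < e" "strong_ball sc T 0 B e \<subseteq> U" by (rule OE)
    have "fun_scale (of_real (1 - t)) f + fun_scale (of_real t) g \<in> strong_ball sc T 0 B e"
      if "f \<in> strong_ball sc T 0 B e" "g \<in> strong_ball sc T 0 B e" "t \<in> {0..1::real}" for f g t
    proof -
      have *: "f \<in> ?D" "g \<in> ?D" "p B f < e" "p B g < e" using that by (auto simp: ball)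
      have "norm (of_real (1 - t) :: 'k) = 1 - t" "norm (of_real t :: 'k) = t"
        using that by (simp_all only: norm_of_real) auto
      then have "p B (fun_scale (of_real (1 - t)) f + fun_scale (of_real t) g) \<le> (1 - t) * p B f + t * p B g"
        using tri [OF Dsc [OF *(1)] Dsc [OF *(2)] B(1), of "of_real (1 - t)" "of_real t"]
          psc [OF *(1) B(1), of "of_real (1 - t)"] psc [OF *(2) B(1), of "of_real t"] by (simp only:)
      also have "\<dots> < e"
        using convex_bound_lt [of "p B f" e "p B g" "1 - t" t] * that by simp
      finally show ?thesis using Dadd [OF Dsc [OF *(1)] Dsc [OF *(2)]] by (simp add: ball)
    qed
    then show "\<exists>V. openin (strong_topology sc T) V \<and> 0 \<in> V \<and> V \<subseteq> U \<and> (\<forall>x\<in>V. \<forall>y\<in>V. \<forall>t\<in>{0..1}.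
        fun_scale (of_real (1 - t)) x + fun_scale (of_real t) y \<in> V)"
      using B(3) opball [OF D0 B(1), of e] self [OF D0 B(1,2)]
      by (intro exI [of _ "strong_ball sc T 0 B e"] conjI ballI)
  qed
qed

end

lemma unit_vec_l10: "a \<in> A \<Longrightarrow> unit_vec a \<in> l10 A"
  by (auto simp: l10_def unit_vec_def)

lemma l10_dual_sum:
  fixes \<Phi> :: "('a \<Rightarrow> 'k::real_normed_field) \<Rightarrow> 'k"
  assumes lin: "linear_map_on (l10 A) fun_scale (*) \<Phi>" and f: "f \<in> l10 A"
  shows "\<Phi> f = (\<Sum>a | f a \<noteq> 0. f a * \<Phi> (unit_vec a))"
proof -
  have zero: "0 \<in> l10 A" by (simp add: l10_def)
  have "\<Phi> (fun_scale 0 0) = 0 * \<Phi> 0" using lin zero unfolding linear_map_on_def by blast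
  then have \<Phi>0: "\<Phi> 0 = 0" by (simp add: fun_scale_def zero_fun_def)
  have trm: "fun_scale (f a) (unit_vec a) \<in> l10 A" if "a \<in> A" for a
    using that by (auto simp: l10_def fun_scale_def unit_vec_def)
  have add: "g + h \<in> l10 A" if "g \<in> l10 A" "h \<in> l10 A" for g h :: "'a \<Rightarrow> 'k"
  proof -
    have "{a. (g + h) a \<noteq> 0} \<subseteq> {a. g a \<noteq> 0} \<union> {a. h a \<noteq> 0}" by auto
    then show ?thesis using that unfolding l10_def
      by (auto intro: finite_subset [of _ "{a. g a \<noteq> 0} \<union> {a. h a \<noteq> 0}"])
  qed
  have *: "(\<Sum>a\<in>S. fun_scale (f a) (unit_vec a)) \<in> l10 A \<and>
      \<Phi> (\<Sum>a\<in>S. fun_scale (f a) (unit_vec a)) = (\<Sum>a\<in>S. f a * \<Phi> (unit_vec a))"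
    if "finite S" "S \<subseteq> A" for S
    using that
  proof (induction S)
    case empty then show ?case using zero \<Phi>0 by (simp add: zero_fun_def)
  next
    case (insert a S)
    then have a: "a \<in> A" and IH: "(\<Sum>a\<in>S. fun_scale (f a) (unit_vec a)) \<in> l10 A"
      "\<Phi> (\<Sum>a\<in>S. fun_scale (f a) (unit_vec a)) = (\<Sum>a\<in>S. f a * \<Phi> (unit_vec a))" by auto
    have "\<Phi> (fun_scale (f a) (unit_vec a)) = f a * \<Phi> (unit_vec a)"
      using lin unit_vec_l10 [OF a] unfolding linear_map_on_def by blast
    moreover have "\<Phi> (fun_scale (f a) (unit_vec a) + (\<Sum>a\<in>S. fun_scale (f a) (unit_vec a))) =
        \<Phi> (fun_scale (f a) (unit_vec a)) + \<Phi> (\<Sum>a\<in>S. fun_scale (f a) (unit_vec a))"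
      using lin trm [OF a] IH(1) unfolding linear_map_on_def by blast
    ultimately show ?case using insert.hyps add [OF trm [OF a] IH(1)] IH(2) by (simp add: plus_fun_def)
  qed
  have fin: "finite {a. f a \<noteq> 0}" "{a. f a \<noteq> 0} \<subseteq> A" using f by (auto simp: l10_def)
  have eval: "(\<Sum>a\<in>S. fun_scale (f a) (unit_vec a)) x = (\<Sum>a\<in>S. if x = a then f a else 0)"
    if "finite S" for S x
    using that by (induction S) (simp_all add: fun_scale_def unit_vec_def)
  have "(\<Sum>a | f a \<noteq> 0. fun_scale (f a) (unit_vec a)) = f"
    using fin by (simp add: fun_eq_iff eval)
  then show ?thesis using * [OF fin] by simp
qed

lemma linf_norm_l10_dual:
  assumes "A \<noteq> {}" and \<Phi>: "\<Phi> \<in> l10_dual A"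
  shows "linf_norm A (l10_dual_to_linf A \<Phi>) \<le> C \<longleftrightarrow> (\<forall>f\<in>l10 A. norm (\<Phi> f) \<le> C * l10_norm f)"
    and "l10_dual_to_linf A \<Phi> \<in> linf A"
proof -
  have lin: "linear_map_on (l10 A) fun_scale (*) \<Phi>" using \<Phi> by (simp add: l10_dual_def)
  have unit: "norm (\<Phi> (unit_vec a)) \<le> M" if "\<forall>f\<in>l10 A. norm (\<Phi> f) \<le> M * l10_norm f" "a \<in> A" for M a
  proof -
    have "{x. (unit_vec a x :: 'b) \<noteq> 0} = {a}" by (auto simp: unit_vec_def)
    then have "l10_norm (unit_vec a :: 'a \<Rightarrow> 'b) = 1" by (simp add: l10_norm_def unit_vec_def)
    then show ?thesis using that unit_vec_l10 [OF that(2)] by fastforce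
  qed
  obtain M where M: "\<forall>f\<in>l10 A. norm (\<Phi> f) \<le> M * l10_norm f" using \<Phi> by (auto simp: l10_dual_def)
  have bdd: "bdd_above ((\<lambda>a. norm (\<Phi> (unit_vec a))) ` A)"
    using unit [OF M] by (auto simp: bdd_above_def)
  then show "l10_dual_to_linf A \<Phi> \<in> linf A" by (simp add: linf_def l10_dual_to_linf_def)
  have eq: "linf_norm A (l10_dual_to_linf A \<Phi>) = (SUP a\<in>A. norm (\<Phi> (unit_vec a)))"
    unfolding linf_norm_def l10_dual_to_linf_def by (rule arg_cong [where f=Sup]) auto
  show "linf_norm A (l10_dual_to_linf A \<Phi>) \<le> C \<longleftrightarrow> (\<forall>f\<in>l10 A. norm (\<Phi> f) \<le> C * l10_norm f)"
  proof
    assume "\<forall>f\<in>l10 A. norm (\<Phi> f) \<le> C * l10_norm f"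
    then show "linf_norm A (l10_dual_to_linf A \<Phi>) \<le> C"
      unfolding eq using unit assms(1) by (intro cSUP_least) auto
  next
    assume le: "linf_norm A (l10_dual_to_linf A \<Phi>) \<le> C"
    show "\<forall>f\<in>l10 A. norm (\<Phi> f) \<le> C * l10_norm f"
    proof
      fix f :: "'a \<Rightarrow> 'b" assume f: "f \<in> l10 A"
      have "norm (\<Phi> (unit_vec a)) \<le> C" if "a \<in> A" for a
        using cSUP_upper [OF that bdd] le eq by simp
      then have "norm (f a * \<Phi> (unit_vec a)) \<le> C * norm (f a)" if "f a \<noteq> 0" for a
        using f that by (auto simp: norm_mult l10_def mult.commute intro: mult_left_mono)
      then have "norm (\<Sum>a | f a \<noteq> 0. f a * \<Phi> (unit_vec a)) \<le> (\<Sum>a | f a \<noteq> 0. C * norm (f a))"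
        by (intro sum_norm_le) simp
      then show "norm (\<Phi> f) \<le> C * l10_norm f"
        unfolding l10_dual_sum [OF lin f] l10_norm_def by (simp add: sum_distrib_left)
    qed
  qed
qed

lemma bij_betw_l10_dual_linf:
  assumes "A \<noteq> {}"
  shows "bij_betw (l10_dual_to_linf A) (l10_dual A) (linf A :: ('a \<Rightarrow> 'k::real_normed_field) set)"
  unfolding bij_betw_def
proof
  show "inj_on (l10_dual_to_linf A) (l10_dual A :: (('a \<Rightarrow> 'k) \<Rightarrow> 'k) set)"
  proof (rule inj_onI)
    fix \<Phi> \<Psi> :: "('a \<Rightarrow> 'k) \<Rightarrow> 'k"
    assume d: "\<Phi> \<in> l10_dual A" "\<Psi> \<in> l10_dual A" and eq: "l10_dual_to_linf A \<Phi> = l10_dual_to_linf A \<Psi>"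
    have u: "\<Phi> (unit_vec a) = \<Psi> (unit_vec a)" if "a \<in> A" for a
      using fun_cong [OF eq, of a] that by (simp add: l10_dual_to_linf_def)
    show "\<Phi> = \<Psi>"
    proof
      fix f show "\<Phi> f = \<Psi> f"
      proof (cases "f \<in> l10 A")
        case True
        then have "a \<in> A" if "f a \<noteq> 0" for a using that by (auto simp: l10_def)
        then show ?thesis
          using l10_dual_sum [OF _ True, of \<Phi>] l10_dual_sum [OF _ True, of \<Psi>] d u
          by (simp add: l10_dual_def)
      next
        case False then show ?thesis using d by (simp add: l10_dual_def)
      qed
    qed
  qed
  show "l10_dual_to_linf A ` l10_dual A = (linf A :: ('a \<Rightarrow> 'k) set)"
  proof
    show "l10_dual_to_linf A ` l10_dual A \<subseteq> (linf A :: ('a \<Rightarrow> 'k) set)"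
      using linf_norm_l10_dual(2) [OF assms] by auto
    show "linf A \<subseteq> l10_dual_to_linf A ` (l10_dual A :: (('a \<Rightarrow> 'k) \<Rightarrow> 'k) set)"
    proof
      fix g :: "'a \<Rightarrow> 'k" assume g: "g \<in> linf A"
      define \<Phi> where "\<Phi> f = (if f \<in> l10 A then \<Sum>a | f a \<noteq> 0. f a * g a else 0)" for f
      have ext: "(\<Sum>a | f a \<noteq> 0. f a * g a) = (\<Sum>a\<in>S. f a * g a)"
        if "finite S" "{a. f a \<noteq> 0} \<subseteq> S" for f S
        using that by (intro sum.mono_neutral_left) auto
      have add: "f + h \<in> l10 A \<and> \<Phi> (f + h) = \<Phi> f + \<Phi> h" if "f \<in> l10 A" "h \<in> l10 A" for f h
      proof -
        let ?S = "{a. f a \<noteq> 0} \<union> {a. h a \<noteq> 0}"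
        have S: "finite ?S" "{a. (f + h) a \<noteq> 0} \<subseteq> ?S" "?S \<subseteq> A" using that by (auto simp: l10_def)
        then have "f + h \<in> l10 A" unfolding l10_def by (auto intro: finite_subset)
        then show ?thesis
          using that ext [OF S(1,2)] ext [OF S(1), of f] ext [OF S(1), of h]
          by (simp add: \<Phi>_def distrib_right sum.distrib)
      qed
      have scale: "\<Phi> (fun_scale c f) = c * \<Phi> f" if "f \<in> l10 A" for c f
      proof -
        have S: "finite {a. f a \<noteq> 0}" "{a. fun_scale c f a \<noteq> 0} \<subseteq> {a. f a \<noteq> 0}" "{a. f a \<noteq> 0} \<subseteq> A"
          using that by (auto simp: l10_def fun_scale_def)
        then have "fun_scale c f \<in> l10 A" unfolding l10_def by (auto intro: finite_subset)
        then show ?thesis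
          using that ext [OF S(1,2)] by (simp add: \<Phi>_def fun_scale_def sum_distrib_left mult.assoc)
      qed
      obtain M where M: "\<forall>a\<in>A. norm (g a) \<le> M" using g by (auto simp: linf_def bdd_above_def)
      have "norm (\<Phi> f) \<le> M * l10_norm f" if f: "f \<in> l10 A" for f
      proof -
        have "norm (f a * g a) \<le> M * norm (f a)" if "f a \<noteq> 0" for a
          using f that M by (auto simp: norm_mult l10_def mult.commute intro: mult_left_mono)
        then have "norm (\<Sum>a | f a \<noteq> 0. f a * g a) \<le> (\<Sum>a | f a \<noteq> 0. M * norm (f a))"
          by (intro sum_norm_le) simp
        then show ?thesis using f by (simp add: \<Phi>_def l10_norm_def sum_distrib_left)
      qed
      then have bound: "\<exists>C. \<forall>f\<in>l10 A. norm (\<Phi> f) \<le> C * l10_norm f" by blast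
      have "\<forall>f. f \<notin> l10 A \<longrightarrow> \<Phi> f = 0" by (simp add: \<Phi>_def)
      with bound have "\<Phi> \<in> l10_dual A"
        unfolding l10_dual_def linear_map_on_def by (simp add: add scale)
      moreover have "l10_dual_to_linf A \<Phi> = g"
      proof
        fix a :: 'a
        have "{x. (unit_vec a x :: 'k) \<noteq> 0} = {a}" by (auto simp: unit_vec_def)
        then have "\<Phi> (unit_vec a) = g a" if "a \<in> A"
          using that by (simp add: \<Phi>_def unit_vec_l10) (simp add: unit_vec_def)
        then show "l10_dual_to_linf A \<Phi> a = g a"
          using g by (auto simp: l10_dual_to_linf_def linf_def)
      qed
      ultimately show "g \<in> l10_dual_to_linf A ` l10_dual A" by blast
    qed
  qed
qed


lemma T_op_unit_vec:
  fixes sc :: "'k::real_normed_field \<Rightarrow> 'c::ab_group_add \<Rightarrow> 'c"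
  assumes "vector_space sc"
  shows "T_op sc (unit_vec a) = a"
proof -
  interpret V: vector_space sc by (rule assms)
  have "{x. (unit_vec a x :: 'k) \<noteq> 0} = {a}" by (auto simp: unit_vec_def)
  then show ?thesis by (simp add: T_op_def) (simp add: unit_vec_def)
qed

end

theory Submission
  imports Defs
begin

text \<open>
  Since \<open>T\<^sub>A\<close> sends the unit vector \<open>e\<^sub>a\<close> to \<open>a\<close>, the adjoint sends a functional \<open>\<phi>\<close> to its
  restriction to \<open>A\<close>, viewed as an element of \<open>\<ell>\<^sub>\<infinity>(A)\<close> (lemma \<open>T_adjoint_eq_restriction\<close>). Hence
  \<open>\<parallel>T\<^sub>A\<^sup>* \<phi>\<parallel> = sup {|\<phi> a| : a \<in> A}\<close>, and for every weakly \<open>p\<close>-summable sequence \<open>\<phi>\<^sub>n\<close> in the strong dual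
  the two properties ask for membership of one and the same scalar sequence in \<open>\<ell>\<^sub>q\<close>, or in \<open>c\<^sub>0\<close>.

  What remains of either property is automatic. The suprema are finite because a continuous
  functional is bounded on bounded sets; for the same reason the adjoint takes its values in
  \<open>\<ell>\<^sub>\<infinity>(A)\<close>. Restriction is linear, the strong dual is locally convex and \<open>\<ell>\<^sub>\<infinity>(A)\<close> is Banach.
\<close>

lemma T_adjoint_eq_restriction:
  fixes sc :: "'k::real_normed_field \<Rightarrow> 'a::ab_group_add \<Rightarrow> 'a"
  assumes "vector_space sc"
  shows "T_adjoint sc A \<phi> = (\<lambda>a. if a \<in> A then \<phi> a else 0)"
  by (simp add: T_adjoint_def l10_dual_to_linf_def adjoint_op_def unit_vec_l10
      T_op_unit_vec [OF assms] fun_eq_iff)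

lemma linf_norm_T_adjoint:
  fixes sc :: "'k::real_normed_field \<Rightarrow> 'a::ab_group_add \<Rightarrow> 'a"
  assumes "vector_space sc"
  shows "linf_norm A (T_adjoint sc A \<phi>) = (SUP a\<in>A. norm (\<phi> a))"
  by (simp add: linf_norm_def T_adjoint_eq_restriction [OF assms] cong: image_cong)

lemma linear_map_on_T_adjoint:
  fixes sc :: "'k::real_normed_field \<Rightarrow> 'a::ab_group_add \<Rightarrow> 'a"
  assumes "vector_space sc"
  shows "linear_map_on X fun_scale fun_scale (T_adjoint sc A)"
  by (simp add: linear_map_on_def T_adjoint_eq_restriction [OF assms] fun_scale_def fun_eq_iff)

lemma (in locally_convex_space) T_adjoint_in_linf:
  assumes "\<phi> \<in> lcs_dual sc T" and "lcs_bounded sc T A"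
  shows "T_adjoint sc A \<phi> \<in> linf A"
  using lcs_dual_bdd_above [OF assms]
  by (simp add: linf_def T_adjoint_eq_restriction [OF vector_space_axioms] cong: image_cong)

theorem theorem16p11:
  fixes sc :: "'k::{real_normed_field, banach} \<Rightarrow> 'a::ab_group_add \<Rightarrow> 'a"
    and T :: "'a topology" and A :: "'a set" and p q :: ereal
  assumes "1 \<le> p" and "p \<le> q"
    and "locally_convex_space sc T"
    and "lcs_bounded sc T A" and "A \<noteq> {}"
  shows "V_star_set sc T p q A \<longleftrightarrow>
    qp_convergent q p fun_scale (strong_topology sc T) fun_scale (linf A) (linf_norm A)
      (T_adjoint sc A)"
proof -
  interpret locally_convex_space sc T by (rule assms(3))
  have bdd: "bdd_above ((\<lambda>a. norm (\<phi> n a)) ` A)"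
    if "weakly_summable fun_scale (strong_topology sc T) p \<phi>" for \<phi> :: "nat \<Rightarrow> 'a \<Rightarrow> 'k" and n
  proof -
    have "\<phi> n \<in> lcs_dual sc T"
      using that by (auto simp: weakly_summable_def topspace_strong_topology)
    then show ?thesis by (rule lcs_dual_bdd_above [OF _ assms(4)])
  qed
  have range: "T_adjoint sc A ` topspace (strong_topology sc T) \<subseteq> linf A"
    using T_adjoint_in_linf [OF _ assms(4)] by (auto simp: topspace_strong_topology)
  have "A \<subseteq> topspace T" using assms(4) by (simp add: lcs_bounded_def)
  then have "V_star_set sc T p q A \<longleftrightarrow>
      (\<forall>\<phi>. weakly_summable fun_scale (strong_topology sc T) p \<phi> \<longrightarrow>
        lp_or_c0 q (\<lambda>n. SUP a\<in>A. norm (\<phi> n a)))"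
    using assms(5) by (auto simp: V_star_set_def intro: bdd)
  also have "\<dots> \<longleftrightarrow> qp_convergent q p fun_scale (strong_topology sc T) fun_scale (linf A)
      (linf_norm A) (T_adjoint sc A)"
    unfolding qp_convergent_def linf_norm_T_adjoint [OF vector_space_axioms]
    using lcs_strong_dual banach_space_linf [OF assms(5)]
      linear_map_on_T_adjoint [OF vector_space_axioms] range by blast
  finally show ?thesis .
qed

end
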